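(* Let $m\ge 1$ and let $V:S^{m-1}\to S^{m-1}$ be a dissipative cubic stochastic operator. Then $V$ is ergodic, i.e. for every $x\in S^{m-1}$ the limit $$\lim_{n\to\infty}\frac{x+Vx+\cdots+V^{n-1}x}{n}$$ exists.
   Context: $S^{m-1}=\{x\in\mathbb{R}^m: x_i\ge 0,\ \sum_{i=1}^m x_i=1\}$. A cubic stochastic operator (c.s.o.) is a map $V:S^{m-1}\to S^{m-1}$ of the form $(Vx)_k=\sum_{i,j,l=1}^m p_{ijl,k}x_ix_jx_l$, $k=1,\dots,m$, where $p_{ijl,k}\ge 0$ is invariant under all permutations of $i,j,l$ and $\sum_{k=1}^m p_{ijl,k}=1$ for all $i,j,l$. For $x\in\mathbb{R}^m$, let $x_{[1]}\ge\cdots\ge x_{[m]}$ denote the coordinates of $x$ in decreasing order. For $x,y\in\mathbb{R}^m$, write $x\prec y$ (equivalently $y\succ x$) if $\sum_{i=1}^k x_{[i]}\le\sum_{i=1}^k y_{[i]}$ for $k=1,\dots,m-1$ and $\sum_{i=1}^m x_{[i]}=\sum_{i=1}^m y_{[i]}$. $V$ is dissipative if $Vx\succ x$ for all $x\in S^{m-1}$. $V^n$ denotes the $n$-th iterate of $V$. *)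

theory Defs
  imports "HOL-Analysis.Analysis" "HOL-Library.Multiset"
begin

(* The dimension m is CARD('m) for a nonempty finite index type 'm; it is arbitrary, m = 1
   included. *)

definition prob_simplex :: "(real ^ 'm) set" where
  "prob_simplex = {x. (\<forall>i. 0 \<le> x $ i) \<and> (\<Sum>i\<in>UNIV. x $ i) = 1}"

(* p i j l k stands for p_{ijl,k}. *)
definition cubic_stochastic_coeffs :: "('m::finite \<Rightarrow> 'm \<Rightarrow> 'm \<Rightarrow> 'm \<Rightarrow> real) \<Rightarrow> bool" where
  "cubic_stochastic_coeffs p \<longleftrightarrow>
     (\<forall>i j l k. 0 \<le> p i j l k) \<and>
     (\<forall>i j l k. p i j l k = p i l j k \<and> p i j l k = p j i l k \<and> p i j l k = p j l i k \<and>
                p i j l k = p l i j k \<and> p i j l k = p l j i k) \<and>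
     (\<forall>i j l. (\<Sum>k\<in>UNIV. p i j l k) = 1)"

(* An operator on the simplex is represented by a total function on real ^ 'm of which only the
   values on the simplex matter; all conditions here and below are restricted to the simplex. *)
definition cubic_stochastic_operator :: "(real ^ 'm \<Rightarrow> real ^ 'm) \<Rightarrow> bool" where
  "cubic_stochastic_operator V \<longleftrightarrow>
     V ` prob_simplex \<subseteq> prob_simplex \<and>
     (\<exists>p. cubic_stochastic_coeffs p \<and>
       (\<forall>x\<in>prob_simplex. \<forall>k.
          V x $ k = (\<Sum>i\<in>UNIV. \<Sum>j\<in>UNIV. \<Sum>l\<in>UNIV. p i j l k * x $ i * x $ j * x $ l)))"

(* The list of all coordinates of x, with multiplicity, in decreasing order. *)
definition decreasing_coords :: "real ^ 'm \<Rightarrow> real list" where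
  "decreasing_coords x =
     rev (sorted_list_of_multiset (image_mset (\<lambda>i. x $ i) (mset_set UNIV)))"

(* x_{[k]}, meaningful for k in {1..CARD('m)}; list positions start at 0. *)
definition decreasing_coord :: "real ^ 'm \<Rightarrow> nat \<Rightarrow> real" where
  "decreasing_coord x k = decreasing_coords x ! (k - 1)"

definition majorized_by :: "real ^ 'm \<Rightarrow> real ^ 'm \<Rightarrow> bool" where
  "majorized_by x y \<longleftrightarrow>
     (\<forall>k\<in>{1..CARD('m) - 1}.
        (\<Sum>i=1..k. decreasing_coord x i) \<le> (\<Sum>i=1..k. decreasing_coord y i)) \<and>
     (\<Sum>i=1..CARD('m). decreasing_coord x i) = (\<Sum>i=1..CARD('m). decreasing_coord y i)"

definition dissipative :: "(real ^ 'm \<Rightarrow> real ^ 'm) \<Rightarrow> bool" where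
  "dissipative V \<longleftrightarrow> (\<forall>x\<in>prob_simplex. majorized_by x (V x))"

(* The average at n = 0 is the junk value 0, which does not affect convergence. *)
definition ergodic :: "(real ^ 'm \<Rightarrow> real ^ 'm) \<Rightarrow> bool" where
  "ergodic V \<longleftrightarrow>
     (\<forall>x\<in>prob_simplex. convergent (\<lambda>n::nat. (\<Sum>i<n. (V ^^ i) x) /\<^sub>R real n))"

end

theory Submission
  imports Defs
begin

text \<open>Majorization makes every partial sum of the decreasingly ordered coordinates monotone along
  an orbit, so the ordered coordinates converge. The orbit is therefore asymptotic to a sequence of
  rearrangements of one limit vector, which takes finitely many values. By uniform continuity
  the operator maps each term of that sequence to the next one from some point on, so the sequence
  is eventually periodic and its Cesaro means converge.\<close>

lemma cesaro_null:
  fixes e :: "nat \<Rightarrow> 'a::real_normed_vector"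
  assumes "e \<longlonglongrightarrow> 0"
  shows "(\<lambda>n. (\<Sum>i<n. e i) /\<^sub>R real n) \<longlonglongrightarrow> 0"
proof (rule LIMSEQ_I)
  fix r :: real
  assume r: "0 < r"
  obtain N where N: "\<And>n. n \<ge> N \<Longrightarrow> norm (e n) < r / 2"
    using LIMSEQ_D[OF assms, of "r / 2"] r by auto
  define C where "C = (\<Sum>i<N. norm (e i))"
  \<comment> \<open>From \<open>M\<close> on, the fixed head \<open>C\<close> contributes less than
    \<open>r / 2\<close> to the mean; the terms past \<open>N\<close> contribute at most another
    \<open>r / 2\<close>.\<close>
  obtain M :: nat where M: "2 * C / r < real M"
    using reals_Archimedean2 by blast
  have "norm ((\<Sum>i<n. e i) /\<^sub>R real n) < r" if n: "n \<ge> max (max N M) 1" for n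
  proof -
    have "(\<Sum>i<n. norm (e i)) = C + (\<Sum>i=N..<n. norm (e i))"
      unfolding C_def lessThan_atLeast0
      by (rule sum.atLeastLessThan_concat[symmetric]) (use n in auto)
    also have "(\<Sum>i=N..<n. norm (e i)) \<le> (\<Sum>i=N..<n. r / 2)"
      by (rule sum_mono) (use N less_imp_le in auto)
    also have "(\<Sum>i=N..<n. r / 2) \<le> real n * (r / 2)"
      using r by (simp add: mult_right_mono)
    finally have "norm (\<Sum>i<n. e i) \<le> C + real n * (r / 2)"
      using norm_sum[of e "{..<n}"] by linarith
    moreover have "2 * C < real n * r"
    proof -
      have "2 * C < real M * r" using M r by (simp add: field_simps)
      also have "\<dots> \<le> real n * r" using n r by (intro mult_right_mono) auto
      finally show ?thesis .
    qed
    ultimately have "norm (\<Sum>i<n. e i) < r * real n" by (simp add: field_simps)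
    then show ?thesis using n by (simp add: field_simps)
  qed
  then show "\<exists>no. \<forall>n\<ge>no. norm ((\<Sum>i<n. e i) /\<^sub>R real n - 0) < r"
    by (intro exI[of _ "max (max N M) 1"]) simp
qed

text \<open>Any index from \<open>a + p\<close> on can be lowered by \<open>p\<close> without
  changing the value, so every value already occurs below \<open>a + p\<close>.\<close>

lemma eventually_periodic_finite_range:
  fixes D :: "nat \<Rightarrow> 'a"
  assumes "p > 0" and "\<And>n. n \<ge> a \<Longrightarrow> D (n + p) = D n"
  shows "finite (range D)"
proof -
  have "D n \<in> D ` {..<a + p}" for n
  proof (induction n rule: less_induct)
    case (less n)
    show ?case
    proof (cases "n < a + p")
      case False
      then have "D n = D (n - p)" using assms(2)[of "n - p"] by simp
      moreover have "n - p < n" using False \<open>p > 0\<close> by simp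
      ultimately show ?thesis using less by simp
    qed simp
  qed
  then show ?thesis by (meson finite_imageI finite_lessThan finite_subset image_subsetI)
qed

text \<open>The limit is the mean \<open>c\<close> over one period. The deviation \<open>D\<close>
  of the partial sums from the linear growth \<open>n * c\<close> is again eventually periodic,
  hence bounded, and vanishes after division by \<open>n\<close>.\<close>

lemma cesaro_eventually_periodic:
  fixes f :: "nat \<Rightarrow> 'a::real_normed_vector"
  assumes p: "p > 0" and per: "\<And>n. n \<ge> a \<Longrightarrow> f (n + p) = f n"
  shows "convergent (\<lambda>n. (\<Sum>i<n. f i) /\<^sub>R real n)"
proof -
  define P where "P n = (\<Sum>i=n..<n + p. f i)" for n
  define c where "c = P a /\<^sub>R real p"
  define D where "D n = (\<Sum>i<n. f i) - real n *\<^sub>R c" for n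
  \<comment> \<open>Moving the window one place drops \<open>f (a + k)\<close> and gains
    \<open>f (a + k + p)\<close>, which are equal.\<close>
  have P: "P (a + k) = P a" for k
  proof (induction k)
    case (Suc k)
    have "P (Suc (a + k)) + f (a + k) = P (a + k) + f (a + k + p)"
      using sum.atLeast_Suc_lessThan[of "a + k" "a + k + p" f] p
      by (simp add: P_def algebra_simps)
    then show ?case using Suc per[of "a + k"] by simp
  qed simp
  have "D (n + p) = D n" if "n \<ge> a" for n
  proof -
    have "(\<Sum>i<n + p. f i) = (\<Sum>i<n. f i) + P n"
      unfolding P_def lessThan_atLeast0 by (rule sum.atLeastLessThan_concat[symmetric]) auto
    moreover have "P n = real p *\<^sub>R c"
      using P[of "n - a"] that p by (simp add: c_def)
    ultimately show ?thesis by (simp add: D_def algebra_simps)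
  qed
  then have "finite (range D)" by (rule eventually_periodic_finite_range[OF p])
  then have "Bseq D" by (simp add: Bseq_eq_bounded finite_imp_bounded)
  then have "(\<lambda>n. inverse (real n) *\<^sub>R D n) \<longlonglongrightarrow> 0"
    unfolding tendsto_Zfun_iff diff_0_right Bseq_def[symmetric]
    by (intro bounded_bilinear.Zfun_prod_Bfun[OF bounded_bilinear_scaleR])
      (use lim_inverse_n[where 'a = real] in \<open>simp_all add: tendsto_Zfun_iff\<close>)
  then have "(\<lambda>n. inverse (real n) *\<^sub>R D n + c) \<longlonglongrightarrow> 0 + c"
    by (intro tendsto_add tendsto_const)
  then have "(\<lambda>n. (\<Sum>i<n. f i) /\<^sub>R real n) \<longlonglongrightarrow> 0 + c"
  proof (rule Lim_transform_eventually)
    show "\<forall>\<^sub>F n in sequentially.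
        inverse (real n) *\<^sub>R D n + c = (\<Sum>i<n. f i) /\<^sub>R real n"
      \<comment> \<open>At \<open>n = 0\<close> the left side is \<open>c\<close> but the right side
        is 0.\<close>
      using eventually_gt_at_top[of 0]
      by eventually_elim (simp add: D_def algebra_simps)
  qed
  then show ?thesis by (rule convergentI)
qed

text \<open>Removing the other points of the finite set leaves an open neighbourhood of 0, which the
  sequence must enter for good.\<close>

lemma eventually_eq_0_finite_range:
  fixes d :: "nat \<Rightarrow> 'a::real_normed_vector"
  assumes "finite S" and "\<And>n. d n \<in> S" and "d \<longlonglongrightarrow> 0"
  shows "\<forall>\<^sub>F n in sequentially. d n = 0"
proof -
  have "open (- (S - {0}))" by (intro open_Compl finite_imp_closed finite_Diff assms(1))
  then have "\<forall>\<^sub>F n in sequentially. d n \<in> - (S - {0})"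
    by (rule topological_tendstoD[OF assms(3)]) simp
  then show ?thesis by eventually_elim (use assms(2) in auto)
qed

text \<open>The sequence \<open>f\<close> is not assumed to be an orbit of \<open>W\<close>. That it
  becomes one eventually is forced by the finiteness of \<open>F\<close>, and Cesaro means do not
  see the null difference between \<open>x\<close> and \<open>f\<close>.\<close>

lemma cesaro_orbit_asymptotic_finite:
  fixes W :: "'a::euclidean_space \<Rightarrow> 'a"
  assumes cont: "continuous_on UNIV W" and orbit: "\<And>n. x (Suc n) = W (x n)"
    and fin: "finite F" and f: "\<And>n. f n \<in> F"
    and lim: "(\<lambda>n. x n - f n) \<longlonglongrightarrow> 0"
  shows "convergent (\<lambda>n. (\<Sum>i<n. x i) /\<^sub>R real n)"
proof -
  have "Bseq (\<lambda>n. x n - f n)"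
    using lim by (simp add: convergent_imp_Bseq convergentI)
  moreover have "Bseq f"
    using finite_imp_bounded[OF fin] f
    by (auto simp: Bseq_eq_bounded intro: bounded_subset)
  ultimately have bx: "bounded (range x)"
    using bounded_plus_comp[of "\<lambda>n. x n - f n" UNIV f] by (simp add: Bseq_eq_bounded)
  \<comment> \<open>A compact set containing both sequences, so that continuity of \<open>W\<close>
    becomes uniform along them.\<close>
  define K where "K = closure (range x) \<union> F"
  have "compact K"
    unfolding K_def using bx fin by (intro compact_Un) (simp_all add: compact_closure finite_imp_compact)
  then have uc: "uniformly_continuous_on K W"
    by (intro compact_uniformly_continuous continuous_on_subset[OF cont]) auto
  have xK: "x n \<in> K" and fK: "f n \<in> K" for n
    using f closure_subset[of "range x"] by (auto simp: K_def)
  have "(\<lambda>n. dist (W (x n)) (W (f n))) \<longlonglongrightarrow> 0"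
    using uc[unfolded uniformly_continuous_on_sequentially] xK fK lim
    by (simp add: dist_norm tendsto_norm_zero_iff)
  then have "(\<lambda>n. x (Suc n) - W (f n)) \<longlonglongrightarrow> 0"
    by (simp add: dist_norm tendsto_norm_zero_iff orbit)
  \<comment> \<open>Both \<open>W (f n)\<close> and \<open>f (Suc n)\<close> are asymptotic to
    \<open>x (Suc n)\<close>, which cancels.\<close>
  from tendsto_diff[OF this LIMSEQ_Suc[OF lim]]
  have "(\<lambda>n. f (Suc n) - W (f n)) \<longlonglongrightarrow> 0" by simp
  then have "\<forall>\<^sub>F n in sequentially. f (Suc n) - W (f n) = 0"
    by (rule eventually_eq_0_finite_range
        [where S = "(\<lambda>(u, v). u - W v) ` (F \<times> F)", rotated 2])
      (use fin f in auto)
  then obtain N where step: "\<And>n. n \<ge> N \<Longrightarrow> f (Suc n) = W (f n)"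
    by (auto simp: eventually_sequentially)
  \<comment> \<open>By pigeonhole some value recurs after \<open>N\<close>; from there
    \<open>step\<close> makes the two tails agree, with period \<open>b - a\<close>.\<close>
  have "\<not> inj_on f {N..}"
    using fin f by (meson finite_imageD finite_subset image_subsetI infinite_Ici)
  then obtain a b where ab: "N \<le> a" "a < b" "f a = f b"
    unfolding inj_on_def by (metis atLeast_iff linorder_neqE_nat)
  have shift: "f (a + k) = f (b + k)" for k
    by (induction k) (use ab step in auto)
  have "convergent (\<lambda>n. (\<Sum>i<n. f i) /\<^sub>R real n)"
  proof (rule cesaro_eventually_periodic[where p = "b - a" and a = a])
    show "f (n + (b - a)) = f n" if "n \<ge> a" for n
      using shift[of "n - a"] that ab by (simp add: algebra_simps)
  qed (use ab in simp)
  then obtain c where "(\<lambda>n. (\<Sum>i<n. f i) /\<^sub>R real n) \<longlonglongrightarrow> c"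
    by (auto simp: convergent_def)
  from tendsto_add[OF this cesaro_null[OF lim]] show ?thesis
    by (auto simp: scaleR_add_right[symmetric] sum.distrib[symmetric] intro: convergentI)
qed

lemma length_decreasing_coords [simp]:
  "length (decreasing_coords (x :: real ^ 'm)) = CARD('m)"
  by (simp add: decreasing_coords_def flip: size_mset)

lemma set_decreasing_coords [simp]:
  "set (decreasing_coords x) = range (\<lambda>i. x $ i)"
  by (simp add: decreasing_coords_def)

lemma prob_simplex_coord_le_1: "x \<in> prob_simplex \<Longrightarrow> x $ i \<le> 1"
  using member_le_sum[of i UNIV "\<lambda>i. x $ i"] by (simp add: prob_simplex_def)

theorem theorem5p3:
  fixes V :: "real ^ 'm \<Rightarrow> real ^ 'm"
  assumes "cubic_stochastic_operator V"
    and "dissipative V"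
  shows "ergodic V"
  unfolding ergodic_def
proof
  fix x0 :: "real ^ 'm"
  assume x0: "x0 \<in> prob_simplex"
  from assms(1) obtain p where maps: "V ` prob_simplex \<subseteq> prob_simplex"
    and p: "\<And>x k. x \<in> prob_simplex \<Longrightarrow>
      V x $ k = (\<Sum>i\<in>UNIV. \<Sum>j\<in>UNIV. \<Sum>l\<in>UNIV. p i j l k * x $ i * x $ j * x $ l)"
    unfolding cubic_stochastic_operator_def by blast
  \<comment> \<open>V is unconstrained off the simplex, so continuity is taken from its polynomial extension W.\<close>
  define W :: "real ^ 'm \<Rightarrow> real ^ 'm" where
    "W x = (\<chi> k. \<Sum>i\<in>UNIV. \<Sum>j\<in>UNIV. \<Sum>l\<in>UNIV. p i j l k * x $ i * x $ j * x $ l)" for x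
  have cont: "continuous_on UNIV W"
    unfolding W_def by (intro continuous_intros)
  define x where "x n = (V ^^ n) x0" for n
  have x: "x n \<in> prob_simplex" for n
    by (induction n) (use maps x0 in \<open>auto simp: x_def\<close>)
  have orbit: "x (Suc n) = W (x n)" for n
    using p[OF x[of n]] by (simp add: x_def W_def vec_eq_iff)
  define m where "m = CARD('m)"
  define S where "S k n = (\<Sum>i=1..k. decreasing_coord (x n) i)" for k n
  have le_1: "decreasing_coord (x n) i \<le> 1" if "i \<in> {1..m}" for i n
  proof -
    have "decreasing_coord (x n) i \<in> set (decreasing_coords (x n))"
      unfolding decreasing_coord_def by (rule nth_mem) (use that in \<open>auto simp: m_def\<close>)
    then show ?thesis using prob_simplex_coord_le_1[OF x[of n]] by auto
  qed
  have conv_S: "convergent (S k)" if "k \<le> m" for k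
  proof (rule Bseq_mono_convergent)
    have le: "S k n \<le> S k (Suc n)" for n
    proof -
      have maj: "majorized_by (x n) (x (Suc n))"
        using assms(2) x[of n] by (simp add: dissipative_def x_def)
      \<comment> \<open>The inequalities in \<open>majorized_by\<close> cover only the last case;
        \<open>k = 0\<close> is an empty sum and \<open>k = m\<close> is the equality of total
        sums.\<close>
      consider "k = 0" | "k = m" | "k \<in> {1..m - 1}" using \<open>k \<le> m\<close> by atomize_elim auto
      then show ?thesis
        using maj by cases (auto simp: S_def majorized_by_def m_def)
    qed
    then show "\<forall>i n. i \<le> n \<longrightarrow> S k i \<le> S k n"
      by (simp add: lift_Suc_mono_le)
    have "S k n \<le> real k" for n
      using sum_bounded_above[of "{1..k}" "decreasing_coord (x n)" 1] le_1 that
      by (auto simp: S_def)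
    then have "S k n \<in> {S k 0..real k}" for n
      using lift_Suc_mono_le[of "S k" 0 n] le by simp
    then show "Bseq (S k)"
      unfolding Bseq_eq_bounded
      by (intro bounded_subset[OF bounded_closed_interval[of "S k 0" "real k"]] image_subsetI)
  qed
  \<comment> \<open>A single ordered coordinate is the difference of two consecutive partial sums.
    Coordinates count from 1 and list positions from 0, hence \<open>Suc j\<close>.\<close>
  have "convergent (\<lambda>n. decreasing_coord (x n) (Suc j))" if "j < m" for j
    using convergent_diff[OF conv_S[of "Suc j"] conv_S[of j]] that by (simp add: S_def)
  then have "convergent (\<lambda>n. decreasing_coords (x n) ! j)" if "j < m" for j
    using that by (simp add: decreasing_coord_def)
  then obtain L where L: "\<And>j. j < m \<Longrightarrow> (\<lambda>n. decreasing_coords (x n) ! j) \<longlonglongrightarrow> L j"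
    unfolding convergent_def by metis
  have "\<exists>j<m. x n $ i = decreasing_coords (x n) ! j" for n i
  proof -
    have "x n $ i \<in> set (decreasing_coords (x n))" by simp
    then show ?thesis unfolding in_set_conv_nth by (auto simp: m_def)
  qed
  \<comment> \<open>\<open>\<sigma> n i\<close> is some position of coordinate \<open>i\<close> in
    the sorted list. Ties may give two coordinates the same position; what counts is that only
    finitely many maps \<open>\<sigma> n\<close> are possible.\<close>
  then obtain \<sigma> where \<sigma>: "\<And>n i. \<sigma> n i < m"
    "\<And>n i. x n $ i = decreasing_coords (x n) ! \<sigma> n i" by metis
  define f :: "nat \<Rightarrow> real ^ 'm" where "f n = (\<chi> i. L (\<sigma> n i))" for n
  let ?F = "(\<lambda>s. \<chi> i. L (s i)) ` (UNIV \<rightarrow>\<^sub>E {..<m}) :: (real ^ 'm) set"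
  have "convergent (\<lambda>n. (\<Sum>i<n. x i) /\<^sub>R real n)"
  proof (rule cesaro_orbit_asymptotic_finite[where W = W and F = ?F and f = f])
    show "continuous_on UNIV W" by (fact cont)
    show "x (Suc n) = W (x n)" for n by (fact orbit)
    show "finite ?F" by (intro finite_imageI finite_PiE) auto
    show "f n \<in> ?F" for n
      unfolding f_def using \<sigma>(1) by (intro imageI) auto
    have "(\<lambda>n. (x n - f n) $ i) \<longlonglongrightarrow> 0" for i
    \<comment> \<open>The position \<open>\<sigma> n i\<close> changes with \<open>n\<close>, so the
      error is bounded by the sum of the errors at all positions.\<close>
    proof (rule Lim_null_comparison)
      show "\<forall>\<^sub>F n in sequentially.
          norm ((x n - f n) $ i) \<le> (\<Sum>j<m. \<bar>decreasing_coords (x n) ! j - L j\<bar>)"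
      proof (intro always_eventually allI)
        fix n
        have "norm ((x n - f n) $ i) = \<bar>decreasing_coords (x n) ! \<sigma> n i - L (\<sigma> n i)\<bar>"
          by (simp add: f_def flip: \<sigma>(2))
        also have "\<dots> \<le> (\<Sum>j<m. \<bar>decreasing_coords (x n) ! j - L j\<bar>)"
          using \<sigma>(1) by (intro member_le_sum) auto
        finally show "norm ((x n - f n) $ i) \<le> \<dots>" .
      qed
      show "(\<lambda>n. \<Sum>j<m. \<bar>decreasing_coords (x n) ! j - L j\<bar>) \<longlonglongrightarrow> 0"
        by (intro tendsto_null_sum tendsto_rabs_zero LIM_zero L) auto
    qed
    then show "(\<lambda>n. x n - f n) \<longlonglongrightarrow> 0"
      by (intro vec_tendstoI) simp
  qed
  then show "convergent (\<lambda>n. (\<Sum>i<n. (V ^^ i) x0) /\<^sub>R real n)"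
    by (simp add: x_def)
qed

end
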